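(* Let $\mathcal{U}$ be a complex Banach algebra with unity $1$, and let $w$ be an invertible element of $\mathcal{U}$ with $w\in\mathcal{Z}(\mathcal{U})$. Let $\phi:\mathcal{U}\to\mathcal{U}$ be an additive mapping such that for all $a,b\in\mathcal{U}$ with $ab=w$ one has $\phi([a,b])=[\phi(a),b]=[a,\phi(b)]$. Then $\phi$ is a commuting map, i.e. $[\phi(a),a]=0$ for all $a\in\mathcal{U}$.
   Context: $[a,b]=ab-ba$ denotes the Lie product, and $\mathcal{Z}(\mathcal{U})$ is the center of $\mathcal{U}$. Additive mappings are not assumed to be linear or continuous. *)

theory Defs
  imports Complex_Main
begin

text \<open>
  The distribution has no class of complex algebras, so complex scalar multiplication is added to
  the library's real Banach algebras, with the real scalar multiplication as its restriction.
  The unit comes from \<^class>\<open>monoid_mult\<close>, not \<^class>\<open>real_normed_algebra_1\<close>, so neither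
  \<open>norm 1 = 1\<close> nor \<open>1 \<noteq> 0\<close> is imposed.
\<close>

class complex_banach_algebra_1 = real_normed_algebra + monoid_mult + banach +
  fixes scaleC :: "complex \<Rightarrow> 'a \<Rightarrow> 'a"
  assumes scaleC_add_right: "scaleC c (x + y) = scaleC c x + scaleC c y"
    and scaleC_add_left: "scaleC (c + d) x = scaleC c x + scaleC d x"
    and scaleC_scaleC: "scaleC c (scaleC d x) = scaleC (c * d) x"
    and scaleC_of_real: "scaleC (complex_of_real r) x = scaleR r x"
    and mult_scaleC_left: "scaleC c x * y = scaleC c (x * y)"
    and mult_scaleC_right: "x * scaleC c y = scaleC c (x * y)"
    and norm_scaleC: "norm (scaleC c x) = cmod c * norm x"

instantiation complex :: complex_banach_algebra_1
begin

definition scaleC_complex :: "complex \<Rightarrow> complex \<Rightarrow> complex"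
  where "scaleC_complex c x = c * x"

instance
  by standard (simp_all add: scaleC_complex_def algebra_simps norm_mult scaleR_conv_of_real)

end

definition lie_product :: "'a::ring \<Rightarrow> 'a \<Rightarrow> 'a"
  where "lie_product a b = a * b - b * a"

definition center :: "'a::semigroup_mult set"
  where "center = {z. \<forall>x. z * x = x * z}"

definition invertible_element :: "'a::monoid_mult \<Rightarrow> bool"
  where "invertible_element a \<longleftrightarrow> (\<exists>b. a * b = 1 \<and> b * a = 1)"

definition commuting_map :: "('a::ring \<Rightarrow> 'a) \<Rightarrow> bool"
  where "commuting_map f \<longleftrightarrow> (\<forall>a. lie_product (f a) a = 0)"

end

theory Submission
  imports Defs
begin

text \<open>
  If \<open>a\<close> is invertible with inverse \<open>c\<close>, the hypothesis applies to the factorisation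
  \<open>w = a (c w)\<close>. Its two factors commute, so \<open>\<phi>\<close> of their Lie product is \<open>0\<close>, and hence \<open>\<phi> a\<close>
  commutes with \<open>c w\<close>. The invertible central factor \<open>w\<close> can be cancelled, and what commutes with
  \<open>c\<close> commutes with its inverse \<open>a\<close>. Thus \<open>\<phi> a\<close> commutes with \<open>a\<close> whenever \<open>a\<close> is invertible
  (lemma \<open>commutes_with_invertible\<close>).

  For arbitrary \<open>a\<close>, let \<open>s\<close> be a scalar multiple of \<open>1\<close> so large that the Neumann series makes
  both \<open>s + a\<close> and \<open>(s + s) + a\<close> invertible (lemma \<open>invertible_scalar_add\<close>). Then \<open>\<phi> s + \<phi> a\<close> and
  \<open>\<phi> s + \<phi> s + \<phi> a\<close> both commute with \<open>a\<close>. Subtracting, \<open>\<phi> s\<close> commutes with \<open>a\<close>, and therefore so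
  does \<open>\<phi> a\<close>. Taking \<open>s\<close> and \<open>s + s\<close> as the two shifts makes \<open>\<phi> (s + s) = \<phi> s + \<phi> s\<close>
  available from additivity.
\<close>

text \<open>
  The factor \<open>norm 1\<close> accounts for the exponent \<open>0\<close>, since the norm of the unit need not be \<open>1\<close>.
\<close>

lemma norm_power_le:
  fixes x :: "'a::{real_normed_algebra, monoid_mult}"
  shows "norm (x ^ n) \<le> norm (1::'a) * norm x ^ n"
proof (induction n)
  case (Suc n)
  have "norm (x ^ Suc n) \<le> norm x * norm (x ^ n)"
    by (simp add: norm_mult_ineq)
  also have "\<dots> \<le> norm x * (norm (1::'a) * norm x ^ n)"
    using Suc by (simp add: mult_left_mono)
  finally show ?case
    by (simp add: mult_ac)
qed simp

text \<open>
  The inverse is the Neumann series \<open>\<Sum>n. x ^ n\<close>: multiplying it by \<open>1 - x\<close> on either side gives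
  a telescoping series with sum \<open>1\<close>.
\<close>

lemma invertible_one_minus:
  fixes x :: "'a::{real_normed_algebra, monoid_mult, banach}"
  assumes "norm x < 1"
  shows "invertible_element (1 - x)"
proof -
  have "summable (\<lambda>n. norm (1::'a) * norm x ^ n)"
    using assms by (intro summable_mult summable_geometric) simp
  then have smb: "summable (\<lambda>n. x ^ n)"
    by (rule summable_comparison_test') (rule norm_power_le)
  define b where "b = (\<Sum>n. x ^ n)"
  have b: "(\<lambda>n. x ^ n) sums b"
    unfolding b_def using smb by (rule summable_sums)
  have telescope: "(\<lambda>n. x ^ n - x ^ Suc n) sums 1"
    using telescope_sums'[OF summable_LIMSEQ_zero[OF smb]] by simp
  have "(\<lambda>n. x ^ n - x ^ Suc n) sums ((1 - x) * b)"
    using sums_mult[OF b, of "1 - x"] by (simp add: left_diff_distrib)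
  then have "(1 - x) * b = 1"
    using telescope by (rule sums_unique2)
  moreover have "(\<lambda>n. x ^ n - x ^ Suc n) sums (b * (1 - x))"
    using sums_mult2[OF b, of "1 - x"] by (simp add: right_diff_distrib power_commutes)
  then have "b * (1 - x) = 1"
    using telescope by (rule sums_unique2)
  ultimately show ?thesis
    unfolding invertible_element_def by blast
qed

lemma invertible_scalar_add:
  fixes a :: "'a::{real_normed_algebra, monoid_mult, banach}"
  assumes "norm a < t"
  shows "invertible_element (t *\<^sub>R 1 + a)"
proof -
  have t: "t > 0"
    using assms norm_ge_zero[of a] by linarith
  define x where "x = - (inverse t *\<^sub>R a)"
  have "norm x < 1"
    using assms t by (simp add: x_def field_simps)
  then obtain b where b: "(1 - x) * b = 1" "b * (1 - x) = 1"
    using invertible_one_minus unfolding invertible_element_def by blast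
  have "t *\<^sub>R 1 + a = t *\<^sub>R (1 - x)"
    using t by (simp add: x_def scaleR_add_right)
  then have "(t *\<^sub>R 1 + a) * (inverse t *\<^sub>R b) = 1" "(inverse t *\<^sub>R b) * (t *\<^sub>R 1 + a) = 1"
    using b t by simp_all
  then show ?thesis
    unfolding invertible_element_def by blast
qed

lemma commutes_with_inverse:
  fixes a c y :: "'a::monoid_mult"
  assumes "a * c = 1" "c * a = 1" "y * c = c * y"
  shows "y * a = a * y"
proof -
  have "y * a = (a * c) * y * a"
    using assms by simp
  also have "\<dots> = a * (c * y) * a"
    by (simp only: mult.assoc)
  also have "\<dots> = a * y * (c * a)"
    using assms(3) by (simp only: mult.assoc flip: assms(3))
  finally show ?thesis
    using assms by simp
qed

text \<open>
  With \<open>c\<close> the inverse of \<open>a\<close> and \<open>b = c w\<close>, centrality of \<open>w\<close> gives \<open>a b = b a = w\<close>. The Lie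
  product identity then says that \<open>\<phi> a\<close> commutes with \<open>c w\<close>, hence with \<open>c\<close> and with \<open>a\<close>.
\<close>

lemma commutes_with_invertible:
  fixes \<phi> :: "'a::{ring, monoid_mult} \<Rightarrow> 'a"
  assumes w: "invertible_element w" "w \<in> center"
    and "\<phi> 0 = 0"
    and lie: "\<And>a b. a * b = w \<Longrightarrow> \<phi> (lie_product a b) = lie_product (\<phi> a) b"
    and "invertible_element a"
  shows "\<phi> a * a = a * \<phi> a"
proof -
  obtain c where c: "a * c = 1" "c * a = 1"
    using assms(5) unfolding invertible_element_def by blast
  obtain v where v: "w * v = 1"
    using w(1) unfolding invertible_element_def by blast
  have central: "w * x = x * w" for x
    using w(2) unfolding center_def by blast
  have ab: "a * (c * w) = w"
    using c by (simp flip: mult.assoc)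
  have ba: "(c * w) * a = w"
    using c by (simp add: mult.assoc central[of a]) (simp flip: mult.assoc)
  have comm: "\<phi> a * (c * w) = (c * w) * \<phi> a"
    using lie[OF ab] ab ba \<open>\<phi> 0 = 0\<close> by (simp add: lie_product_def)
  have "\<phi> a * c * w = c * \<phi> a * w"
    using comm by (simp add: mult.assoc central[of "\<phi> a"])
  then have "\<phi> a * c * (w * v) = c * \<phi> a * (w * v)"
    by (simp flip: mult.assoc)
  then have "\<phi> a * c = c * \<phi> a"
    using v by simp
  then show ?thesis
    by (rule commutes_with_inverse[OF c])
qed

theorem lemma3p1:
  fixes w :: "'a::complex_banach_algebra_1" and \<phi> :: "'a \<Rightarrow> 'a"
  assumes "invertible_element w"
    and "w \<in> center"
    and "Modules.additive \<phi>"
    and "\<And>a b. a * b = w \<Longrightarrow>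
           \<phi> (lie_product a b) = lie_product (\<phi> a) b \<and>
           lie_product (\<phi> a) b = lie_product a (\<phi> b)"
  shows "commuting_map \<phi>"
proof -
  have add: "\<phi> (x + y) = \<phi> x + \<phi> y" for x y
    using assms(3) by (rule additive.add)
  have inv: "\<phi> x * x = x * \<phi> x" if "invertible_element x" for x
    using assms(1,2) additive.zero[OF assms(3)]
  proof (rule commutes_with_invertible)
    show "\<phi> (lie_product a b) = lie_product (\<phi> a) b" if "a * b = w" for a b
      using assms(4)[OF that] by simp
  qed (rule that)
  have "\<phi> a * a = a * \<phi> a" for a
  proof -
    define t where "t = norm a + 1"
    define s :: 'a where "s = t *\<^sub>R 1"
    have scalar: "s * x = x * s" for x
      by (simp add: s_def)
    have "invertible_element (s + a)"
      unfolding s_def by (rule invertible_scalar_add) (simp add: t_def)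
    from inv[OF this] have one: "(\<phi> s + \<phi> a) * a = a * (\<phi> s + \<phi> a)"
      by (simp add: add distrib_left distrib_right scalar)
    have "s + s + a = (t + t) *\<^sub>R 1 + a"
      by (simp only: s_def scaleR_add_left)
    moreover have "norm a < t + t"
      using norm_ge_zero[of a] unfolding t_def by linarith
    ultimately have "invertible_element (s + s + a)"
      using invertible_scalar_add by metis
    from inv[OF this] have two: "(\<phi> s + \<phi> s + \<phi> a) * a = a * (\<phi> s + \<phi> s + \<phi> a)"
      by (simp add: add distrib_left distrib_right scalar)
    have "\<phi> s * a = a * \<phi> s"
      using one two by (simp add: distrib_left distrib_right add.assoc)
    then show ?thesis
      using one by (simp add: distrib_left distrib_right)
  qed
  then show ?thesis
    by (simp add: commuting_map_def lie_product_def)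
qed

end
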